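(* According to relative interval analysis, $l(\mathrm{Nai},\mathrm{Eag})=[-\frac14,1]$, i.e., $\mathrm{Min}(\mathrm{Nai},\mathrm{Eag})=-\frac14$ and $\mathrm{Max}(\mathrm{Nai},\mathrm{Eag})=1$.
   Context: Online frequent items problem: an input sequence is $I=a_1,\ldots,a_n$ of items from an infinite universe, $n=|I|$. An algorithm maintains a buffer holding one item; $s_t$ is the buffer content after step $t$; at step $1$ the buffer receives $a_1$, and at each later step $t$ the algorithm either keeps $s_{t-1}$ or replaces it by $a_t$. With $f_I(a)=|\{i:a_i=a\}|/n$, the aggregate frequency of $\mathcal A$ on $I$ is $\mathcal A(I)=\sum_{t=1}^n f_I(s^{\mathcal A}_t)$. Nai sets $s_t=a_t$ for all $t$. Eag: let $t^*=\min\{t\in\{1,\ldots,n-1\}: a_t=a_{t+1}\}$ if such $t$ exists, else $t^*=n$; Eag sets $s_t=a_t$ for $t\le t^*$ and $s_t=a_{t^*}$ for $t>t^*$. Relative interval analysis: $\mathrm{Min}_{\mathcal A,\mathcal B}(n)=\min_{|I|=n}\{\mathcal A(I)-\mathcal B(I)\}$, $\mathrm{Max}_{\mathcal A,\mathcal B}(n)=\max_{|I|=n}\{\mathcal A(I)-\mathcal B(I)\}$, $\mathrm{Min}(\mathcal A,\mathcal B)=\liminf_{n\to\infty}\mathrm{Min}_{\mathcal A,\mathcal B}(n)/n$, $\mathrm{Max}(\mathcal A,\mathcal B)=\limsup_{n\to\infty}\mathrm{Max}_{\mathcal A,\mathcal B}(n)/n$, and the relative interval is $l(\mathcal A,\mathcal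 B)=[\mathrm{Min}(\mathcal A,\mathcal B),\mathrm{Max}(\mathcal A,\mathcal B)]$. *)

theory Defs
  imports Complex_Main "HOL-Library.Extended_Real"
begin

text \<open>Input positions and time steps are numbered from 1, so \<open>item I t\<close> is the $t$-th item
  of the input, for \<open>1 \<le> t \<le> length I\<close>.\<close>

definition item :: "'a list \<Rightarrow> nat \<Rightarrow> 'a" where
  "item I t = I ! (t - 1)"

definition freq :: "'a list \<Rightarrow> 'a \<Rightarrow> real" where
  "freq I a = real (card {i \<in> {1..length I}. item I i = a}) / real (length I)"

text \<open>An algorithm is represented by its buffer contents: \<open>A I t\<close> is the content after step
  \<open>t\<close> on input \<open>I\<close>. Only the values for \<open>1 \<le> t \<le> length I\<close> are meaningful. The predicate
  below singles out the legitimate online algorithms: the buffer changes only as the model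
  permits, and its content after step \<open>t\<close> depends only on the first \<open>t\<close> items.\<close>

type_synonym 'a alg = "'a list \<Rightarrow> nat \<Rightarrow> 'a"

definition online_alg :: "'a alg \<Rightarrow> bool" where
  "online_alg A \<longleftrightarrow>
     (\<forall>I. I \<noteq> [] \<longrightarrow> A I 1 = item I 1) \<and>
     (\<forall>I. \<forall>t\<in>{2..length I}. A I t = A I (t - 1) \<or> A I t = item I t) \<and>
     (\<forall>I J. \<forall>t\<in>{1..min (length I) (length J)}. take t I = take t J \<longrightarrow> A I t = A J t)"

definition aggregate_freq :: "'a alg \<Rightarrow> 'a list \<Rightarrow> real" where
  "aggregate_freq A I = (\<Sum>t = 1..length I. freq I (A I t))"

definition nai :: "'a alg" where
  "nai I t = item I t"

definition eag_stop :: "'a list \<Rightarrow> nat" where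
  "eag_stop I =
     (if \<exists>t\<in>{1..length I - 1}. item I t = item I (t + 1)
      then Min {t \<in> {1..length I - 1}. item I t = item I (t + 1)}
      else length I)"

definition eag :: "'a alg" where
  "eag I t = (if t \<le> eag_stop I then item I t else item I (eag_stop I))"

definition diff_values :: "'a alg \<Rightarrow> 'a alg \<Rightarrow> nat \<Rightarrow> real set" where
  "diff_values A B n = {aggregate_freq A I - aggregate_freq B I | I. length I = n}"

definition min_diff :: "'a alg \<Rightarrow> 'a alg \<Rightarrow> nat \<Rightarrow> real" where
  "min_diff A B n = Min (diff_values A B n)"

definition max_diff :: "'a alg \<Rightarrow> 'a alg \<Rightarrow> nat \<Rightarrow> real" where
  "max_diff A B n = Max (diff_values A B n)"

definition rel_min :: "'a alg \<Rightarrow> 'a alg \<Rightarrow> ereal" where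
  "rel_min A B = liminf (\<lambda>n. ereal (min_diff A B n / real n))"

definition rel_max :: "'a alg \<Rightarrow> 'a alg \<Rightarrow> ereal" where
  "rel_max A B = limsup (\<lambda>n. ereal (max_diff A B n / real n))"

definition relative_interval :: "'a alg \<Rightarrow> 'a alg \<Rightarrow> ereal set" where
  "relative_interval A B = {rel_min A B..rel_max A B}"

text \<open>There are infinitely many inputs of each length, but only finitely many difference
  values, so the minimum and maximum above are attained.\<close>

lemma finite_diff_values: "finite (diff_values A B n)"
proof -
  define S where "S = (\<lambda>k. real k / real n) ` {..n * n}"
  have agg: "aggregate_freq A I \<in> S" if n: "length I = n" for A :: "'a alg" and I
  proof -
    define c where "c = (\<lambda>a. card {i \<in> {1..n}. item I i = a})"
    have "c a \<le> n" for a
      unfolding c_def using card_mono[of "{1..n}" "{i \<in> {1..n}. item I i = a}"] by fastforce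
    then have "(\<Sum>t = 1..n. c (A I t)) \<le> n * n"
      using sum_bounded_above[of "{1..n}" "\<lambda>t. c (A I t)" n] by simp
    moreover have "aggregate_freq A I = real (\<Sum>t = 1..n. c (A I t)) / real n"
      by (simp add: aggregate_freq_def freq_def n c_def sum_divide_distrib)
    ultimately show ?thesis unfolding S_def by blast
  qed
  have "diff_values A B n \<subseteq> (\<lambda>(x, y). x - y) ` (S \<times> S)"
    unfolding diff_values_def using agg by fast
  moreover have "finite S" by (simp add: S_def)
  ultimately show ?thesis by (meson finite_SigmaI finite_imageI finite_subset)
qed

lemma diff_values_nonempty: "diff_values A B n \<noteq> {}"
  unfolding diff_values_def using Ex_list_of_length[of n] by blast

lemma item_eq_if_take_eq:
  assumes "take t I = take t J" "1 \<le> s" "s \<le> t"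
  shows "item I s = item J s"
  using assms nth_take[of "s - 1" t I] nth_take[of "s - 1" t J] by (simp add: item_def)

lemma online_alg_nai: "online_alg nai"
  unfolding online_alg_def nai_def
proof (intro conjI allI ballI impI)
  fix I J :: "'a list" and t
  assume "t \<in> {1..min (length I) (length J)}" "take t I = take t J"
  then show "item I t = item J t" by (intro item_eq_if_take_eq[of t]) auto
qed simp_all

lemma eag_stop_least:
  assumes "t \<in> {1..length I - 1}" "item I t = item I (t + 1)"
  shows "eag_stop I \<in> {1..length I - 1}" "item I (eag_stop I) = item I (eag_stop I + 1)"
    "eag_stop I \<le> t"
proof -
  let ?T = "{t \<in> {1..length I - 1}. item I t = item I (t + 1)}"
  have t: "t \<in> ?T" using assms by simp
  have e: "eag_stop I = Min ?T" using assms unfolding eag_stop_def by auto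
  have "Min ?T \<in> ?T" using t by (intro Min_in) auto
  then show "eag_stop I \<in> {1..length I - 1}" "item I (eag_stop I) = item I (eag_stop I + 1)"
    unfolding e by auto
  show "eag_stop I \<le> t" unfolding e using t by (intro Min_le) auto
qed

lemma eag_stop_cases:
  "(eag_stop I \<in> {1..length I - 1} \<and> item I (eag_stop I) = item I (eag_stop I + 1))
    \<or> eag_stop I = length I"
proof (cases "\<exists>t\<in>{1..length I - 1}. item I t = item I (t + 1)")
  case True
  then show ?thesis using eag_stop_least(1,2) by blast
next
  case False
  then have "eag_stop I = length I" unfolding eag_stop_def by (rule if_not_P)
  then show ?thesis by simp
qed

lemma online_alg_eag: "online_alg (eag :: 'a alg)"
proof -
  have stop: "eag_stop J \<le> eag_stop I"
    if eq: "take t I = take t J" and t: "t \<le> length I" "t \<le> length J" and less: "eag_stop I < t"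
    for I J :: "'a list" and t
  proof -
    have "eag_stop I \<in> {1..length I - 1}" "item I (eag_stop I) = item I (eag_stop I + 1)"
      using eag_stop_cases[of I] less t by auto
    then show ?thesis
      using item_eq_if_take_eq[OF eq, of "eag_stop I"] item_eq_if_take_eq[OF eq, of "eag_stop I + 1"] less t
      by (intro eag_stop_least(3)) auto
  qed
  have "eag I t = eag J t"
    if eq: "take t I = take t J" and t: "1 \<le> t" "t \<le> length I" "t \<le> length J"
    for I J :: "'a list" and t
  proof (cases "eag_stop I < t")
    case True
    then have "eag_stop J = eag_stop I"
      using stop[OF eq t(2,3)] stop[OF eq[symmetric] t(3,2)] by simp
    moreover have "1 \<le> eag_stop I"
      using eag_stop_cases[of I] t by auto
    ultimately show ?thesis using True item_eq_if_take_eq[OF eq, of "eag_stop I"] by (simp add: eag_def)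
  next
    case False
    then have "\<not> eag_stop J < t"
      using stop[OF eq[symmetric] t(3,2)] by auto
    then show ?thesis using False item_eq_if_take_eq[OF eq, of t] t by (simp add: eag_def)
  qed
  then have "\<forall>I J. \<forall>t\<in>{1..min (length I) (length J)}. take t I = take t J \<longrightarrow>
      eag I t = (eag J t :: 'a)"
    by (metis atLeastAtMost_iff min.bounded_iff)
  moreover have "eag I 1 = item I 1" if "I \<noteq> []" for I :: "'a list"
  proof -
    have "1 \<le> eag_stop I" using eag_stop_cases[of I] that by (auto simp: Suc_le_eq)
    then show ?thesis by (simp add: eag_def)
  qed
  moreover have "eag I t = eag I (t - 1) \<or> eag I t = item I t" for I :: "'a list" and t
  proof (cases "t \<le> eag_stop I")
    case True
    then show ?thesis by (simp add: eag_def)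
  next
    case False
    then have "t - 1 = eag_stop I \<or> \<not> t - 1 \<le> eag_stop I" by arith
    then show ?thesis using False by (auto simp: eag_def)
  qed
  ultimately show ?thesis unfolding online_alg_def by blast
qed

end

theory Submission
  imports Defs
begin

text \<open>Let Eag freeze on \<open>a\<close>, and let \<open>k\<close> be the number of occurrences of \<open>a\<close> in the input.
  In each step Nai loses at most \<open>k / n\<close> to Eag, and it can lose only at the \<open>n - k\<close> positions
  not holding \<open>a\<close>; so its total loss is at most \<open>(n - k) k / n \<le> n / 4\<close>. This is
  asymptotically tight for \<open>n div 2\<close> copies of \<open>a\<close> followed by distinct items. The upper
  bound 1 is trivial and is approached on the inputs \<open>a, a, b, b, \<dots>, b\<close>.\<close>

text \<open>\<open>count_list\<close> can be computed recursively over the extremal inputs, built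
  from \<open>replicate\<close> and append. \<open>Suc\<close> carries the 0-based list indices to
  the 1-based positions.\<close>

lemma freq_eq_count_list: "freq I a = real (count_list I a) / real (length I)"
proof -
  have "bij_betw Suc {i. i < length I \<and> I ! i = a} {i \<in> {1..length I}. item I i = a}"
    by (rule bij_betw_byWitness[where f' = "\<lambda>i. i - 1"]) (auto simp: item_def)
  then have "card {i \<in> {1..length I}. item I i = a} = card {i. i < length I \<and> I ! i = a}"
    by (rule bij_betw_same_card[symmetric])
  also have "\<dots> = length (filter (\<lambda>x. x = a) I)"
    by (simp add: length_filter_conv_card)
  also have "\<dots> = count_list I a"
    by (induction I) auto
  finally show ?thesis by (simp add: freq_def)
qed

lemma freq_nonneg: "0 \<le> freq I a"
  by (simp add: freq_def)

lemma freq_le_1: "freq I a \<le> 1"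
  by (simp add: freq_eq_count_list count_le_length divide_le_eq_1)

lemma nai_minus_eag:
  "aggregate_freq nai I - aggregate_freq eag I
    = (\<Sum>t = 1..length I. freq I (item I t) - freq I (eag I t))"
  by (simp add: aggregate_freq_def nai_def sum_subtractf)

lemma nai_minus_eag_le: "aggregate_freq nai I - aggregate_freq eag I \<le> length I"
proof -
  have "freq I x - freq I y \<le> 1" for x y
    using freq_le_1[of I x] freq_nonneg[of I y] by simp
  then show ?thesis
    unfolding nai_minus_eag
    using sum_bounded_above[of "{1..length I}" "\<lambda>t. freq I (item I t) - freq I (eag I t)" 1]
    by simp
qed

lemma nai_minus_eag_ge: "- (real (length I) / 4) \<le> aggregate_freq nai I - aggregate_freq eag I"
proof (cases "I = []")
  case True
  then show ?thesis by (simp add: aggregate_freq_def)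
next
  case False
  define n where "n = real (length I)"
  have n: "n > 0" using False by (simp add: n_def)
  \<comment> \<open>If no two adjacent items agree, \<open>eag_stop I\<close> is
    \<open>length I\<close> and \<open>a\<close> is the last item; Eag then equals Nai throughout,
    and the bound below still applies.\<close>
  define a where "a = item I (eag_stop I)"
  define k where "k = n * freq I a"
  let ?P = "\<lambda>t. item I t = a"
  have card: "real (card {t \<in> {1..length I}. \<not> ?P t}) = n - k"
  proof -
    have "card {t \<in> {1..length I}. ?P t} + card {t \<in> {1..length I}. \<not> ?P t} = length I"
      using card_Int_Diff[of "{1..length I}" "Collect ?P"]
      by (simp add: Int_def set_diff_eq)
    moreover have "k = card {t \<in> {1..length I}. ?P t}"
      using n by (simp add: k_def n_def freq_def)
    ultimately show ?thesis by (simp add: n_def)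
  qed
  \<comment> \<open>Expanding the square gives the AM-GM bound on \<open>(n - k) * k\<close>, with
    equality at k = n/2; this is where 1/4 comes from.\<close>
  have "0 \<le> (n - 2 * k)\<^sup>2" by simp
  then have "(n - k) * k \<le> n\<^sup>2 / 4" by (simp add: power2_eq_square algebra_simps)
  then have "- (n / 4) \<le> - ((n - k) * (k / n))"
    using n by (simp add: field_simps power2_eq_square)
  also have "\<dots> = - ((n - k) * freq I a)" using n by (simp add: k_def)
  also have "\<dots> = (\<Sum>t = 1..length I. if ?P t then 0 else - freq I a)"
    using card by (simp add: sum.If_cases Int_def conj_commute)
  \<comment> \<open>Termwise: up to the stop both buffers agree, so the difference is 0; afterwards
    Eag holds \<open>a\<close>, so it is 0 where the item is \<open>a\<close> and at least
    \<open>- freq I a\<close> elsewhere.\<close>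
  also have "\<dots> \<le> (\<Sum>t = 1..length I. freq I (item I t) - freq I (eag I t))"
    by (intro sum_mono) (auto simp: eag_def a_def[symmetric] freq_nonneg)
  finally show ?thesis by (simp add: nai_minus_eag n_def)
qed

text \<open>Both extremal families are instances of this computation.\<close>

lemma nai_minus_eag_replicate_append:
  assumes a: "a \<notin> set xs" and k: "2 \<le> k" and m: "\<And>x. x \<in> set xs \<Longrightarrow> count_list xs x = m"
  shows "aggregate_freq nai (replicate k a @ xs) - aggregate_freq eag (replicate k a @ xs)
    = real (length xs) * (real m - real k) / real (k + length xs)"
proof -
  define I where "I = replicate k a @ xs"
  have len: "length I = k + length xs" by (simp add: I_def)
  have rep: "count_list (replicate k a) x = (if x = a then k else 0)" for x
    by (induction k) auto
  have first: "item I t = a" if "t \<in> {1..k}" for t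
    using that by (auto simp: I_def item_def nth_append)
  \<comment> \<open>Since k is at least 2, the input starts with two copies of \<open>a\<close>; Eag
    freezes at once and holds \<open>a\<close> forever.\<close>
  have "1 \<in> {1..length I - 1}" "item I 1 = item I (1 + 1)"
    using k len first[of 1] first[of "Suc (Suc 0)"] by auto
  then have "eag_stop I = 1" using eag_stop_least(1,3)[of 1 I] by force
  then have eag: "eag I t = a" if "1 \<le> t" for t
    using that k first[of 1] by (auto simp: eag_def)
  have "freq I (item I t) - freq I (eag I t) = (real m - real k) / real (length I)"
    if t: "t \<in> {k + 1..length I}" for t
  proof -
    have "item I t \<in> set xs"
      using t len by (auto simp: I_def item_def nth_append)
    moreover from this have "item I t \<noteq> a" using a by auto
    ultimately show ?thesis
      using t a m eag[of t] by (simp add: freq_eq_count_list diff_divide_distrib)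
        (simp add: I_def rep count_list_0_iff)
  qed
  moreover have "freq I (item I t) - freq I (eag I t) = 0" if "t \<in> {1..k}" for t
    using that eag[of t] first[of t] by simp
  moreover have "{1..length I} = {1..k} \<union> {k + 1..length I}" "{1..k} \<inter> {k + 1..length I} = {}"
    using len by auto
  ultimately have "(\<Sum>t = 1..length I. freq I (item I t) - freq I (eag I t))
      = real (length xs) * ((real m - real k) / real (length I))"
    using len by (simp add: sum.union_disjoint)
  then show ?thesis by (simp add: nai_minus_eag len flip: I_def)
qed

lemma min_diff_le:
  assumes "length I = n"
  shows "min_diff A B n \<le> aggregate_freq A I - aggregate_freq B I"
  unfolding min_diff_def using assms
  by (intro Min_le finite_diff_values) (auto simp: diff_values_def)

lemma max_diff_ge:
  assumes "length I = n"
  shows "aggregate_freq A I - aggregate_freq B I \<le> max_diff A B n"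
  unfolding max_diff_def using assms
  by (intro Max_ge finite_diff_values) (auto simp: diff_values_def)

text \<open>The minimum is attained, so the bound for a single input carries over to it.\<close>

lemma min_diff_nai_eag_ge: "- (real n / 4) \<le> min_diff (nai :: 'a alg) eag n"
proof -
  have "min_diff (nai :: 'a alg) eag n \<in> diff_values (nai :: 'a alg) eag n"
    unfolding min_diff_def by (rule Min_in[OF finite_diff_values diff_values_nonempty])
  then obtain I :: "'a list" where "length I = n"
    "min_diff (nai :: 'a alg) eag n = aggregate_freq nai I - aggregate_freq eag I"
    unfolding diff_values_def by blast
  with nai_minus_eag_ge[of I] show ?thesis by simp
qed

lemma max_diff_nai_eag_le: "max_diff (nai :: 'a alg) eag n \<le> real n"
proof -
  have "max_diff (nai :: 'a alg) eag n \<in> diff_values (nai :: 'a alg) eag n"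
    unfolding max_diff_def by (rule Max_in[OF finite_diff_values diff_values_nonempty])
  then obtain I :: "'a list" where "length I = n"
    "max_diff (nai :: 'a alg) eag n = aggregate_freq nai I - aggregate_freq eag I"
    unfolding diff_values_def by blast
  with nai_minus_eag_le[of I] show ?thesis by simp
qed

text \<open>The infinite universe supplies \<open>n - n div 2\<close> distinct items other than
  \<open>a\<close>, each of count m = 1; \<open>4 \<le> n\<close> makes the leading block of
  \<open>a\<close> at least 2 long.\<close>

lemma min_diff_nai_eag_le:
  assumes "infinite (UNIV :: 'a set)" "4 \<le> n"
  shows "min_diff (nai :: 'a alg) eag n
    \<le> real (n - n div 2) * (1 - real (n div 2)) / real n"
proof -
  fix a :: 'a
  have "infinite (UNIV - {a})" using assms by simp
  then obtain X where X: "X \<subseteq> UNIV - {a}" "finite X" "card X = n - n div 2"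
    using infinite_arbitrarily_large[of "UNIV - {a}" "n - n div 2"] by metis
  then obtain xs where xs: "set xs = X" "distinct xs"
    using finite_distinct_list by blast
  have len: "length xs = n - n div 2" using xs X distinct_card by fastforce
  have "a \<notin> set xs" using xs X by auto
  moreover have "count_list xs x = 1" if "x \<in> set xs" for x
    using that xs(2) by (induction xs) (auto simp: count_list_0_iff)
  ultimately show ?thesis
    using nai_minus_eag_replicate_append[of a xs "n div 2" 1] assms(2) len
      min_diff_le[of "replicate (n div 2) a @ xs" n nai eag] by simp
qed

text \<open>Here k = 2 and m = n - 2: Eag is stuck with an item occurring twice while Nai collects
  the dominant one. For n = 2 the second block is empty and the bound is 0.\<close>

lemma max_diff_nai_eag_ge:
  assumes "infinite (UNIV :: 'a set)" "2 \<le> n"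
  shows "real (n - 2) * (real (n - 2) - 2) / real n \<le> max_diff (nai :: 'a alg) eag n"
proof -
  fix a :: 'a
  obtain b where b: "b \<noteq> a"
    using assms(1) ex_new_if_finite[of "{a}"] by auto
  have "count_list (replicate l b) b = l" for l
    by (induction l) auto
  then show ?thesis
    using nai_minus_eag_replicate_append[of a "replicate (n - 2) b" 2 "n - 2"] assms(2) b
      max_diff_ge[of "replicate 2 a @ replicate (n - 2) b" n nai eag] by auto
qed

lemma min_diff_nai_eag_tendsto:
  assumes "infinite (UNIV :: 'a set)"
  shows "(\<lambda>n. min_diff (nai :: 'a alg) eag n / real n) \<longlonglongrightarrow> - 1 / 4"
proof (rule tendsto_sandwich[OF _ _ tendsto_const])
  show "\<forall>\<^sub>F n in sequentially. - 1 / 4 \<le> min_diff (nai :: 'a alg) eag n / real n"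
    using eventually_gt_at_top[of 0]
    by eventually_elim (use min_diff_nai_eag_ge in \<open>simp add: field_simps\<close>)
  show "\<forall>\<^sub>F n in sequentially. min_diff (nai :: 'a alg) eag n / real n
      \<le> 3 / 4 / real n - 1 / 4"
    using eventually_ge_at_top[of 4]
  proof eventually_elim
    case (elim n)
    define d where "d = n div 2"
    have "n \<le> 2 * d + 1" by (simp add: d_def)
    then have "real n \<le> real (2 * d + 1)" by (rule of_nat_mono)
    then have d: "real n \<le> 2 * real d + 1" by simp
    have half: "real n / 2 \<le> real (n - d)" by (simp add: d_def field_simps)
    \<comment> \<open>The bound d \<ge> (n - 1)/2 gives 1 - d \<le> (3 - n)/2.\<close>
    have "real (n - d) * (1 - real d) \<le> real (n - d) * ((3 - real n) / 2)"
      using d by (intro mult_left_mono) (simp_all add: field_simps)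
    \<comment> \<open>The second factor is negative for n \<ge> 4, so shrinking \<open>n - d\<close>
      to n/2 enlarges the product.\<close>
    also have "\<dots> \<le> (real n / 2) * ((3 - real n) / 2)"
      using half elim by (intro mult_right_mono_neg) simp_all
    finally have "real (n - d) * (1 - real d) \<le> (real n / 2) * ((3 - real n) / 2)" .
    then have "real (n - d) * (1 - real d) / real n \<le> (real n / 2) * ((3 - real n) / 2) / real n"
      by (rule divide_right_mono) simp
    also have "\<dots> = (3 - real n) / 4" using elim by simp
    finally have "min_diff (nai :: 'a alg) eag n \<le> (3 - real n) / 4"
      using min_diff_nai_eag_le[OF assms elim] unfolding d_def by (rule order_trans[rotated])
    then show ?case using elim by (simp add: field_simps)
  qed
  show "(\<lambda>n. 3 / 4 / real n - 1 / 4) \<longlonglongrightarrow> - 1 / 4"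
    using tendsto_diff[OF lim_const_over_n[of "3 / 4 :: real"] tendsto_const[of "1 / 4"]] by simp
qed

lemma max_diff_nai_eag_tendsto:
  assumes "infinite (UNIV :: 'a set)"
  shows "(\<lambda>n. max_diff (nai :: 'a alg) eag n / real n) \<longlonglongrightarrow> 1"
proof (rule tendsto_sandwich[OF _ _ _ tendsto_const])
  show "\<forall>\<^sub>F n in sequentially. 1 - 6 / real n
      \<le> max_diff (nai :: 'a alg) eag n / real n"
    using eventually_ge_at_top[of 2]
  proof eventually_elim
    case (elim n)
    \<comment> \<open>The right side is (n - 2)(n - 4) = n(n - 6) + 8, whence the constant
      6.\<close>
    have "(real n - 6) * real n \<le> real (n - 2) * (real (n - 2) - 2)"
      using elim by (simp add: algebra_simps)
    then have "real n - 6 \<le> real (n - 2) * (real (n - 2) - 2) / real n"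
      using elim by (simp add: pos_le_divide_eq)
    also note max_diff_nai_eag_ge[OF assms elim]
    finally have "(real n - 6) / real n \<le> max_diff (nai :: 'a alg) eag n / real n"
      by (rule divide_right_mono) simp
    then show ?case using elim by (simp add: diff_divide_distrib)
  qed
  show "\<forall>\<^sub>F n in sequentially. max_diff (nai :: 'a alg) eag n / real n \<le> 1"
    using eventually_gt_at_top[of 0]
    by eventually_elim (use max_diff_nai_eag_le in simp)
  show "(\<lambda>n. 1 - 6 / real n) \<longlonglongrightarrow> 1"
    using tendsto_diff[OF tendsto_const[of 1] lim_const_over_n[of "6 :: real"]] by simp
qed

theorem theorem5:
  assumes "infinite (UNIV :: 'a set)"
  shows "relative_interval (nai :: 'a alg) eag = {ereal (- 1 / 4)..ereal 1} \<and>
    rel_min (nai :: 'a alg) eag = ereal (- 1 / 4) \<and>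
    rel_max (nai :: 'a alg) eag = ereal 1"
proof -
  \<comment> \<open>The normalized extrema converge, so their lower and upper limits are the
    ordinary limits, transferred to \<open>ereal\<close>.\<close>
  have "rel_min (nai :: 'a alg) eag = ereal (- 1 / 4)"
    unfolding rel_min_def
    by (rule lim_imp_Liminf[OF sequentially_bot tendsto_ereal[OF min_diff_nai_eag_tendsto[OF assms]]])
  moreover have "rel_max (nai :: 'a alg) eag = ereal 1"
    unfolding rel_max_def
    by (rule lim_imp_Limsup[OF sequentially_bot tendsto_ereal[OF max_diff_nai_eag_tendsto[OF assms]]])
  ultimately show ?thesis unfolding relative_interval_def by simp
qed

end
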